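(* Let $\mu$ be an ergodic $\sigma$-invariant Borel probability measure on $\Omega=\{-1,0,+1\}^{\mathbb Z}$ which is symmetric and straightforward. Then the reversal symmetrized scenery measure is determined by the global record measure: if $\lambda$ and $\lambda'$ are two scenery measures on $X=\{0,1\}^{\mathbb Z}$ whose global record measures $\rho=(\mu\times\lambda)\circ\Phi^{-1}$ and $\rho'=(\mu\times\lambda')\circ\Phi^{-1}$ satisfy $\rho=\rho'$, then their reversal symmetrized measures satisfy $\check\lambda=\check\lambda'$.
   Context: Let $J=\{-1,0,+1\}$ be the set of steps, whose elements are also written $\mathtt L=-1$, $\mathtt H=0$, $\mathtt R=+1$ (left, hold, right). Let $\Omega=J^{\mathbb Z}$ with its Borel $\sigma$-algebra and left shift $\sigma$, $(\sigma\omega)_n=\omega_{n+1}$. A generalized random walk with holding is given by an ergodic shift-invariant probability measure $\mu$ on $\Omega$ (holding steps are allowed but $\mu(\omega_0=0)=0$ is not excluded). For a word $u=u_1\dots u_n$ over $J$ put $\mu[u]=\mu(\{\omega\in\Omega:\omega_0\dots\omega_{n-1}=u\})$. The mirror image $\overline u$ of $u$ is the word obtained from $u$ by replacing every $\mathtt R$ by $\mathtt L$ and every $\mathtt L$ by $\mathtt R$ (leaving $\mathtt H$ unchanged). The measure $\mu$ is symmetric if $\mu[u]=\mu[\overline u]$ for every finite word $u$ over $J$. It is straightforward if arbitrarily long words of $\mathtt R$'s have positive probability, i.e. $\mu[\mathtt R^N]>0$ for every $N\ge1$, where $\mathtt R^N$ is the word consisting of $N$ letters $\mathtt R$. Let $X=\{0,1\}^{\mathbb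 Z}$ with its Borel $\sigma$-algebra and left shift $T$, $(Tx)_k=x_{k+1}$. A scenery measure is an ergodic $T$-invariant Borel probability measure on $X$. For a word $w=w_1\dots w_n$ over $\{0,1\}$ put $\lambda[w]=\lambda(\{x\in X:x_0\dots x_{n-1}=w\})$ and let $\overleftarrow{w}=w_n\dots w_1$ be the reversed word. The reversal symmetrized measure $\check\lambda$ of $\lambda$ is the $T$-invariant probability measure on $X$ determined by $\check\lambda[w]=\frac12(\lambda[w]+\lambda[\overleftarrow{w}])$ for every finite word $w$. For $\omega\in\Omega$ and $x\in X$ define $r_0(\omega,x)=x_0$; for $n\ge1$, $r_n(\omega,x)=(T^{\omega_0+\cdots+\omega_{n-1}}x)_0$; for $n<0$, $r_n(\omega,x)=(T^{-\omega_{-1}-\omega_{-2}-\cdots-\omega_{n}}x)_0$. The global recording map is $\Phi:\Omega\times X\to X$, $\Phi(\omega,x)=(r_n(\omega,x))_{n\in\mathbb Z}$. The global record measure of a scenery measure $\lambda$ is $\rho=(\mu\times\lambda)\circ\Phi^{-1}$. *)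

theory Defs
  imports "HOL-Probability.Probability"
begin

section \<open>Two-sided sequences\<close>

text \<open>
  \<open>shift_by k\<close> is the \<open>k\<close>-th iterate of the left shift, for every integer \<open>k\<close>
  (lemma \<open>shift_by_eq_funpow\<close>).
\<close>

definition shift_by :: "int \<Rightarrow> (int \<Rightarrow> 'a) \<Rightarrow> (int \<Rightarrow> 'a)" where
  "shift_by k x = (\<lambda>n. x (n + k))"

abbreviation shift :: "(int \<Rightarrow> 'a) \<Rightarrow> (int \<Rightarrow> 'a)" where
  "shift \<equiv> shift_by 1"

definition shift_invariant_prob :: "(int \<Rightarrow> 'a::topological_space) measure \<Rightarrow> bool" where
  "shift_invariant_prob M \<longleftrightarrow>
     sets M = sets borel \<and> prob_space M \<and> distr M borel shift = M"

definition ergodic_shift_prob :: "(int \<Rightarrow> 'a::topological_space) measure \<Rightarrow> bool" where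
  "ergodic_shift_prob M \<longleftrightarrow>
     shift_invariant_prob M \<and>
     (\<forall>A\<in>sets borel. shift -` A = A \<longrightarrow> measure M A = 0 \<or> measure M A = 1)"

definition word_prob :: "(int \<Rightarrow> 'a) measure \<Rightarrow> 'a list \<Rightarrow> real" where
  "word_prob M w = measure M {x. \<forall>i<length w. x (int i) = w ! i}"


section \<open>Generalized random walks with holding\<close>

datatype step = Left | Hold | Right

instantiation step :: discrete_topology
begin

definition open_step :: "step set \<Rightarrow> bool" where
  "open_step A \<longleftrightarrow> True"

instance
  by standard (auto simp: open_step_def)

end

lemma UNIV_step: "(UNIV :: step set) = {Left, Hold, Right}"
  using step.exhaust by auto

instance step :: finite
  by standard (simp add: UNIV_step)

lemma ex_countable_basis_discrete:
  "\<exists>B::'a::{discrete_topology, finite} set set. countable B \<and> open = generate_topology B"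
proof (intro exI conjI)
  show "countable (UNIV :: 'a set set)"
    by (rule countable_finite) simp
  show "open = generate_topology (UNIV :: 'a set set)"
    by (intro ext iffI) (auto intro: generate_topology.Basis Topological_Spaces.open_discrete)
qed

instance step :: second_countable_topology
  by standard (rule ex_countable_basis_discrete)

instance bool :: second_countable_topology
  by standard (rule ex_countable_basis_discrete)

fun displacement :: "step \<Rightarrow> int" where
  "displacement Left = - 1"
| "displacement Hold = 0"
| "displacement Right = 1"

fun mirror :: "step \<Rightarrow> step" where
  "mirror Left = Right"
| "mirror Hold = Hold"
| "mirror Right = Left"

definition symmetric_walk :: "(int \<Rightarrow> step) measure \<Rightarrow> bool" where
  "symmetric_walk \<mu> \<longleftrightarrow> (\<forall>u. word_prob \<mu> u = word_prob \<mu> (map mirror u))"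

definition straightforward_walk :: "(int \<Rightarrow> step) measure \<Rightarrow> bool" where
  "straightforward_walk \<mu> \<longleftrightarrow> (\<forall>N\<ge>1. word_prob \<mu> (replicate N Right) > 0)"


section \<open>Scenery measures and record measures\<close>

text \<open>A scenery is a two-sided sequence over \<open>{0, 1}\<close>, with \<open>0\<close> and \<open>1\<close> encoded as truth values.\<close>

abbreviation scenery_measure :: "(int \<Rightarrow> bool) measure \<Rightarrow> bool" where
  "scenery_measure \<equiv> ergodic_shift_prob"

definition is_reversal_symmetrized ::
    "(int \<Rightarrow> bool) measure \<Rightarrow> (int \<Rightarrow> bool) measure \<Rightarrow> bool" where
  "is_reversal_symmetrized \<nu> \<kappa> \<longleftrightarrow>
     shift_invariant_prob \<kappa> \<and>
     (\<forall>w. word_prob \<kappa> w = (word_prob \<nu> w + word_prob \<nu> (rev w)) / 2)"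

text \<open>
  The description is justified by lemma \<open>ex1_reversal_symmetrized\<close> below: for a shift-invariant
  probability measure there is exactly one reversal symmetrized measure.
\<close>

definition reversal_symmetrized :: "(int \<Rightarrow> bool) measure \<Rightarrow> (int \<Rightarrow> bool) measure" where
  "reversal_symmetrized \<nu> = (THE \<kappa>. is_reversal_symmetrized \<nu> \<kappa>)"

definition position :: "(int \<Rightarrow> step) \<Rightarrow> int \<Rightarrow> int" where
  "position \<omega> n =
     (if n \<ge> 0 then \<Sum>k\<in>{0..<n}. displacement (\<omega> k)
      else - (\<Sum>k\<in>{n..-1}. displacement (\<omega> k)))"

definition record_map :: "(int \<Rightarrow> step) \<times> (int \<Rightarrow> bool) \<Rightarrow> (int \<Rightarrow> bool)" where
  "record_map = (\<lambda>(\<omega>, x). \<lambda>n. shift_by (position \<omega> n) x 0)"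

definition record_measure ::
    "(int \<Rightarrow> step) measure \<Rightarrow> (int \<Rightarrow> bool) measure \<Rightarrow> (int \<Rightarrow> bool) measure" where
  "record_measure \<mu> \<nu> = distr (\<mu> \<Otimes>\<^sub>M \<nu>) borel record_map"


section \<open>The notions are well defined\<close>

lemma shift_by_eq_funpow:
  "(shift_by (int k) :: (int \<Rightarrow> 'a) \<Rightarrow> _) = shift ^^ k"
  "(shift_by (- int k) :: (int \<Rightarrow> 'a) \<Rightarrow> _) = inv shift ^^ k"
proof -
  have inv: "inv shift = (shift_by (- 1) :: (int \<Rightarrow> 'a) \<Rightarrow> _)"
    by (rule inv_equality) (auto simp: shift_by_def)
  show "shift_by (int k) = (shift ^^ k :: (int \<Rightarrow> 'a) \<Rightarrow> _)"
    by (induction k) (auto simp: shift_by_def fun_eq_iff add_ac)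
  show "shift_by (- int k) = (inv shift ^^ k :: (int \<Rightarrow> 'a) \<Rightarrow> _)"
    unfolding inv by (induction k) (auto simp: shift_by_def fun_eq_iff algebra_simps)
qed

lemma borel_measurable_reindex:
  "(\<lambda>x n. x (f n)) \<in> borel_measurable (borel :: (int \<Rightarrow> 'a::topological_space) measure)"
  by (intro borel_measurable_continuous_onI continuous_on_coordinatewise_then_product)
     (rule continuous_on_product_coordinates)

lemma borel_measurable_coordinate:
  "(\<lambda>x. x n) \<in> borel_measurable (borel :: (int \<Rightarrow> 'a::topological_space) measure)"
  by (intro borel_measurable_continuous_onI) (rule continuous_on_product_coordinates)

lemma borel_measurable_shift_by:
  "shift_by k \<in> borel_measurable (borel :: (int \<Rightarrow> 'a::topological_space) measure)"
  using borel_measurable_reindex[of "\<lambda>n. n + k"] by (simp add: shift_by_def[abs_def])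

lemma borel_measurable_word:
  "{x :: int \<Rightarrow> 'a::t1_space. \<forall>i<length w. x (f i) = w ! i} \<in> sets borel"
proof -
  have *: "{x :: int \<Rightarrow> 'a. \<forall>i<length w. x (f i) = w ! i}
      = (\<Inter>i\<in>{..<length w}. (\<lambda>x. x (f i)) -` {w ! i} \<inter> space borel)"
    by auto
  have "(\<lambda>x. x (f i)) -` {w ! i} \<inter> space borel \<in> sets (borel :: (int \<Rightarrow> 'a) measure)" for i
    by (rule measurable_sets[OF borel_measurable_coordinate]) simp
  then show ?thesis
    unfolding * by (cases "w = []") (auto intro!: sets.finite_INT)
qed

lemma shift_invariant_window:
  fixes M :: "(int \<Rightarrow> 'a::t1_space) measure"
  assumes M: "shift_invariant_prob M"
  shows "measure M {x. \<forall>i<length w. x (int i + m) = w ! i} = word_prob M w"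
proof -
  have sM: "sets M = sets borel" and dM: "distr M borel shift = M"
    using M by (auto simp: shift_invariant_prob_def)
  then have spM: "space M = UNIV"
    using sets_eq_imp_space_eq[OF sM] by simp
  have step: "measure M {x. \<forall>i<length w. x (int i + (m + 1)) = w ! i}
      = measure M {x. \<forall>i<length w. x (int i + m) = w ! i}" for m
  proof -
    have "measure M {x. \<forall>i<length w. x (int i + m) = w ! i}
        = measure (distr M borel shift) {x. \<forall>i<length w. x (int i + m) = w ! i}"
      by (simp add: dM)
    also have "\<dots> = measure M (shift -` {x. \<forall>i<length w. x (int i + m) = w ! i} \<inter> space M)"
      by (rule measure_distr)
         (simp_all add: borel_measurable_word borel_measurable_shift_by
            measurable_cong_sets[OF sM refl])
    finally show ?thesis
      by (simp add: spM shift_by_def vimage_def add_ac)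
  qed
  show ?thesis
  proof (induction m rule: int_induct[where k = 0])
    case base
    then show ?case by (simp add: word_prob_def)
  next
    case (step1 i)
    then show ?case using step[of i] by simp
  next
    case (step2 i)
    then show ?case using step[of "i - 1"] by simp
  qed
qed

lemma shift_invariant_prob_eqI:
  fixes P Q :: "(int \<Rightarrow> bool) measure"
  assumes P: "shift_invariant_prob P" and Q: "shift_invariant_prob Q"
    and eq: "\<And>w. word_prob P w = word_prob Q w"
  shows "P = Q"
proof (rule measure_eqI_PiM_infinite[where I = UNIV and M = "\<lambda>_. borel"])
  interpret P: prob_space P using P by (simp add: shift_invariant_prob_def)
  interpret Q: prob_space Q using Q by (simp add: shift_invariant_prob_def)
  have sP: "sets P = sets borel" and sQ: "sets Q = sets borel"
    using P Q by (auto simp: shift_invariant_prob_def)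
  show "sets P = sets (Pi\<^sub>M UNIV (\<lambda>_. borel))" "sets Q = sets (Pi\<^sub>M UNIV (\<lambda>_. borel))"
    by (simp_all add: sP sQ sets_PiM_equal_borel)
  show "finite_measure P" by unfold_locales
  fix A :: "int \<Rightarrow> bool set" and J :: "int set"
  assume J: "finite J"
  define N where "N = nat (Max (insert 0 (abs ` J)))"
  have N: "- int N \<le> j \<and> j \<le> int N" if "j \<in> J" for j
  proof -
    have "\<bar>j\<bar> \<le> Max (insert 0 (abs ` J))"
      by (rule Max_ge) (use J that in auto)
    then show ?thesis by (auto simp: N_def)
  qed
  define W where "W = {w :: bool list. length w = 2 * N + 1 \<and> (\<forall>j\<in>J. w ! nat (j + int N) \<in> A j)}"
  define C where "C w = {x :: int \<Rightarrow> bool. \<forall>i<length w. x (int i + - int N) = w ! i}" for w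
  have emb: "prod_emb UNIV (\<lambda>_. borel) J (Pi\<^sub>E J A) = {x. \<forall>j\<in>J. x j \<in> A j}"
    by (auto simp: prod_emb_def PiE_iff)
  have W_fin: "finite W"
    by (rule finite_subset[OF _ finite_lists_length_eq[of "UNIV :: bool set" "2 * N + 1"]])
       (auto simp: W_def)
  have disj: "disjoint_family_on C W"
    unfolding disjoint_family_on_def
  proof (intro ballI impI)
    fix v w assume vw: "v \<in> W" "w \<in> W" "v \<noteq> w"
    then obtain i where "i < length v" "v ! i \<noteq> w ! i" "length v = length w"
      by (auto simp: W_def list_eq_iff_nth_eq)
    then show "C v \<inter> C w = {}" by (auto simp: C_def)
  qed
  have un: "{x. \<forall>j\<in>J. x j \<in> A j} = (\<Union>w\<in>W. C w)"
  proof (intro set_eqI iffI)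
    fix x assume x: "x \<in> {x. \<forall>j\<in>J. x j \<in> A j}"
    define w where "w = map (\<lambda>i. x (int i - int N)) [0..<2 * N + 1]"
    have len: "length w = 2 * N + 1" by (simp add: w_def)
    have nth: "w ! i = x (int i - int N)" if "i < 2 * N + 1" for i
      using that by (simp add: w_def del: upt_Suc)
    have "w ! nat (j + int N) \<in> A j" if "j \<in> J" for j
    proof -
      have "nat (j + int N) < 2 * N + 1" "int (nat (j + int N)) = j + int N"
        using N[OF that] by auto
      then show ?thesis using x that by (simp add: nth)
    qed
    then have "w \<in> W" by (simp add: W_def len)
    moreover have "x \<in> C w" by (simp add: C_def len nth)
    ultimately show "x \<in> (\<Union>w\<in>W. C w)" by blast
  next
    fix x assume "x \<in> (\<Union>w\<in>W. C w)"
    then obtain w where w: "w \<in> W" "x \<in> C w" by blast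
    have "x j \<in> A j" if "j \<in> J" for j
    proof -
      have *: "nat (j + int N) < length w" "int (nat (j + int N)) + - int N = j"
        using N[OF that] w by (auto simp: W_def)
      have "x (int (nat (j + int N)) + - int N) = w ! nat (j + int N)"
        using w(2) *(1) unfolding C_def by blast
      then show ?thesis using w(1) that unfolding *(2) by (simp add: W_def)
    qed
    then show "x \<in> {x. \<forall>j\<in>J. x j \<in> A j}" by blast
  qed
  have C_sets: "C w \<in> sets borel" for w
    unfolding C_def by (rule borel_measurable_word)
  have "measure P (\<Union>w\<in>W. C w) = (\<Sum>w\<in>W. measure P (C w))"
    by (rule P.finite_measure_finite_Union) (use W_fin disj C_sets in \<open>auto simp: sP\<close>)
  also have "\<dots> = (\<Sum>w\<in>W. measure Q (C w))"
    unfolding C_def by (simp only: shift_invariant_window[OF P] shift_invariant_window[OF Q] eq)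
  also have "\<dots> = measure Q (\<Union>w\<in>W. C w)"
    by (rule Q.finite_measure_finite_Union[symmetric]) (use W_fin disj C_sets in \<open>auto simp: sQ\<close>)
  finally show "emeasure P (prod_emb UNIV (\<lambda>_. borel) J (Pi\<^sub>E J A))
      = emeasure Q (prod_emb UNIV (\<lambda>_. borel) J (Pi\<^sub>E J A))"
    by (simp add: emb un P.emeasure_eq_measure Q.emeasure_eq_measure)
qed

lemma ex1_reversal_symmetrized:
  assumes \<nu>: "shift_invariant_prob \<nu>"
  shows "\<exists>!\<kappa>. is_reversal_symmetrized \<nu> \<kappa>"
proof -
  have s\<nu>: "sets \<nu> = sets borel" and d\<nu>: "distr \<nu> borel shift = \<nu>"
    using \<nu> by (auto simp: shift_invariant_prob_def)
  interpret \<nu>: prob_space \<nu> using \<nu> by (simp add: shift_invariant_prob_def)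
  have sp\<nu>: "space \<nu> = UNIV"
    using sets_eq_imp_space_eq[OF s\<nu>] by simp
  define refl where "refl = (\<lambda>(x :: int \<Rightarrow> bool) n. x (- n))"
  have refl_meas: "refl \<in> borel_measurable \<nu>"
    unfolding refl_def measurable_cong_sets[OF s\<nu> refl] by (rule borel_measurable_reindex)
  have shift_meas: "shift \<in> borel_measurable \<nu>"
    unfolding measurable_cong_sets[OF s\<nu> refl] by (rule borel_measurable_shift_by)
  define F where "F b = (if b then \<nu> else distr \<nu> borel refl)" for b
  have F_sets: "sets (F b) = sets borel" for b
    by (simp add: F_def s\<nu>)
  have F_prob: "prob_space (F b)" for b
    by (simp add: F_def \<nu>.prob_space_axioms \<nu>.prob_space_distr[OF refl_meas])
  define p where "p = measure_pmf (bernoulli_pmf (1 / 2))"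
  have F_kernel: "F \<in> p \<rightarrow>\<^sub>M subprob_algebra borel"
    unfolding p_def by (auto simp: space_subprob_algebra F_sets intro!: prob_space_imp_subprob_space F_prob)
  define \<kappa> where "\<kappa> = p \<bind> F"
  have p_ne: "space p \<noteq> {}" by (simp add: p_def)
  have \<kappa>_sets: "sets \<kappa> = sets borel"
    unfolding \<kappa>_def by (rule sets_bind) (auto simp: F_sets p_ne)
  have \<kappa>_em: "emeasure \<kappa> A = (emeasure \<nu> A + emeasure \<nu> (refl -` A)) / 2"
    if A: "A \<in> sets borel" for A
  proof -
    have "emeasure \<kappa> A = (\<integral>\<^sup>+ b. emeasure (F b) A \<partial>p)"
      unfolding \<kappa>_def by (rule emeasure_bind[OF p_ne F_kernel A])
    also have "\<dots> = (emeasure \<nu> A + emeasure (distr \<nu> borel refl) A) / 2"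
      unfolding p_def
      by (subst nn_integral_measure_pmf_support[where A = UNIV])
         (auto simp: UNIV_bool F_def ennreal_divide_times divide_ennreal_def algebra_simps
            ennreal_half)
    also have "emeasure (distr \<nu> borel refl) A = emeasure \<nu> (refl -` A)"
      by (simp add: emeasure_distr[OF refl_meas A] sp\<nu>)
    finally show ?thesis .
  qed
  have word_\<kappa>: "word_prob \<kappa> w = (word_prob \<nu> w + word_prob \<nu> (rev w)) / 2" for w
  proof -
    let ?C = "{x :: int \<Rightarrow> bool. \<forall>i<length w. x (int i) = w ! i}"
    have "refl -` ?C
        = {x. \<forall>i<length (rev w). x (int i + (1 - int (length w))) = rev w ! i}" (is "_ = ?D")
    proof (intro set_eqI iffI)
      fix x assume x: "x \<in> refl -` ?C"
      show "x \<in> ?D"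
      proof (intro CollectI allI impI)
        fix i assume i: "i < length (rev w)"
        then have "length w - Suc i < length w" by simp
        then have "x (- int (length w - Suc i)) = w ! (length w - Suc i)"
          using x by (simp add: refl_def)
        moreover have "- int (length w - Suc i) = int i + (1 - int (length w))"
          using i by auto
        ultimately show "x (int i + (1 - int (length w))) = rev w ! i"
          using i by (simp only: rev_nth length_rev)
      qed
    next
      fix x assume x: "x \<in> ?D"
      have "x (- int i) = w ! i" if i: "i < length w" for i
      proof -
        have "length w - Suc i < length (rev w)" using i by simp
        then have "x (int (length w - Suc i) + (1 - int (length w))) = rev w ! (length w - Suc i)"
          using x by blast
        moreover have "int (length w - Suc i) + (1 - int (length w)) = - int i"
          using i by auto
        ultimately show ?thesis
          using i by (simp add: rev_nth Suc_diff_Suc)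
      qed
      then show "x \<in> refl -` ?C" by (simp add: refl_def)
    qed
    then have D: "measure \<nu> (refl -` ?C) = word_prob \<nu> (rev w)"
      by (simp only: shift_invariant_window[OF \<nu>])
    have "emeasure \<kappa> ?C = (emeasure \<nu> ?C + emeasure \<nu> (refl -` ?C)) / 2"
      by (rule \<kappa>_em) (rule borel_measurable_word)
    also have "\<dots> = ennreal ((word_prob \<nu> w + word_prob \<nu> (rev w)) / 2)"
      unfolding \<nu>.emeasure_eq_measure D
      by (simp add: word_prob_def ennreal_plus[symmetric] divide_ennreal[symmetric]
            del: ennreal_plus)
    finally show ?thesis
      by (simp add: word_prob_def measure_def)
  qed
  have "prob_space \<kappa>"
    by (rule prob_spaceI)
       (simp add: sets_eq_imp_space_eq[OF \<kappa>_sets] \<kappa>_em \<nu>.emeasure_space_1[unfolded sp\<nu>]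
          ennreal_divide_self)
  moreover have "distr \<kappa> borel shift = \<kappa>"
  proof (rule measure_eqI)
    fix A assume "A \<in> sets (distr \<kappa> borel shift)"
    then have A: "A \<in> sets borel" by simp
    have inv: "emeasure \<nu> (shift -` B) = emeasure \<nu> B" if "B \<in> sets borel" for B
      using emeasure_distr[OF shift_meas that] by (simp add: d\<nu> sp\<nu>)
    have pre: "f -` B \<in> sets borel"
      if "f \<in> borel_measurable borel" "B \<in> sets borel" for f B
      using measurable_sets[OF that] by simp
    have r: "refl -` A \<in> sets borel"
      by (rule pre[OF _ A]) (use refl_meas in \<open>simp add: measurable_cong_sets[OF s\<nu> refl]\<close>)
    have "emeasure (distr \<kappa> borel shift) A = emeasure \<kappa> (shift -` A)"
      using emeasure_distr[of shift \<kappa> borel A] A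
      by (simp add: measurable_cong_sets[OF \<kappa>_sets refl] borel_measurable_shift_by
            sets_eq_imp_space_eq[OF \<kappa>_sets])
    also have "\<dots> = (emeasure \<nu> (shift -` A) + emeasure \<nu> (refl -` shift -` A)) / 2"
      by (intro \<kappa>_em pre[OF borel_measurable_shift_by A])
    also have "refl -` shift -` A = shift_by (- 1) -` refl -` A"
      by (auto simp: refl_def shift_by_def)
    also have "emeasure \<nu> \<dots> = emeasure \<nu> (shift -` shift_by (- 1) -` refl -` A)"
      by (rule inv[symmetric]) (intro pre[OF borel_measurable_shift_by r])
    also have "shift -` shift_by (- 1) -` refl -` A = refl -` A"
      by (auto simp: shift_by_def)
    finally show "emeasure (distr \<kappa> borel shift) A = emeasure \<kappa> A"
      by (simp add: inv[OF A] \<kappa>_em[OF A])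
  qed (simp add: \<kappa>_sets)
  ultimately have inv_\<kappa>: "shift_invariant_prob \<kappa>"
    by (simp add: shift_invariant_prob_def \<kappa>_sets)
  show ?thesis
  proof (rule ex1I)
    show "is_reversal_symmetrized \<nu> \<kappa>"
      using inv_\<kappa> word_\<kappa> by (simp add: is_reversal_symmetrized_def)
  next
    fix \<kappa>' assume "is_reversal_symmetrized \<nu> \<kappa>'"
    then have \<kappa>': "shift_invariant_prob \<kappa>'"
        "\<And>w. word_prob \<kappa>' w = (word_prob \<nu> w + word_prob \<nu> (rev w)) / 2"
      by (simp_all add: is_reversal_symmetrized_def)
    show "\<kappa>' = \<kappa>"
      by (rule shift_invariant_prob_eqI[OF \<kappa>'(1) inv_\<kappa>]) (simp only: \<kappa>'(2) word_\<kappa>)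
  qed
qed

lemma measurable_record_map:
  assumes "sets \<mu> = sets borel" "sets \<nu> = sets borel"
  shows "record_map \<in> borel_measurable (\<mu> \<Otimes>\<^sub>M \<nu>)"
proof -
  have disp: "displacement \<in> borel \<rightarrow>\<^sub>M count_space UNIV"
    by (intro measurableI) (auto intro: borel_open Topological_Spaces.open_discrete)
  have coord: "(\<lambda>p. displacement (fst p k)) \<in> \<mu> \<Otimes>\<^sub>M \<nu> \<rightarrow>\<^sub>M count_space UNIV" for k
  proof -
    have "(\<lambda>\<omega>. \<omega> k) \<in> borel_measurable \<mu>"
      unfolding measurable_cong_sets[OF assms(1) refl] by (rule borel_measurable_coordinate)
    from measurable_compose[OF measurable_compose[OF measurable_fst this] disp]
    show ?thesis .
  qed
  have pos: "(\<lambda>p. position (fst p) n) \<in> \<mu> \<Otimes>\<^sub>M \<nu> \<rightarrow>\<^sub>M count_space UNIV" for n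
  proof -
    have add: "(\<lambda>p. f p + g p :: int) \<in> \<mu> \<Otimes>\<^sub>M \<nu> \<rightarrow>\<^sub>M count_space UNIV"
      if f: "f \<in> \<mu> \<Otimes>\<^sub>M \<nu> \<rightarrow>\<^sub>M count_space UNIV" and g: "g \<in> \<mu> \<Otimes>\<^sub>M \<nu> \<rightarrow>\<^sub>M count_space UNIV" for f g
    proof (rule measurable_compose_countable[where f = "\<lambda>a p. f p + a", OF _ g])
      show "(\<lambda>p. f p + a) \<in> \<mu> \<Otimes>\<^sub>M \<nu> \<rightarrow>\<^sub>M count_space UNIV" for a
        by (rule measurable_compose[OF f]) simp
    qed
    have sum: "(\<lambda>p. \<Sum>k\<in>K. displacement (fst p k)) \<in> \<mu> \<Otimes>\<^sub>M \<nu> \<rightarrow>\<^sub>M count_space UNIV"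
      if "finite K" for K
      using that by (induction K) (auto intro!: add coord)
    show ?thesis
    proof (cases "n \<ge> 0")
      case True
      then show ?thesis using sum[of "{0..<n}"] by (simp add: position_def)
    next
      case False
      then show ?thesis
        using measurable_compose[OF sum[of "{n..-1}"], of uminus "count_space UNIV"]
        by (simp add: position_def)
    qed
  qed
  have "(\<lambda>p. record_map p n) \<in> borel_measurable (\<mu> \<Otimes>\<^sub>M \<nu>)" for n
  proof -
    have scen: "(\<lambda>p. snd p k) \<in> borel_measurable (\<mu> \<Otimes>\<^sub>M \<nu>)" for k
    proof -
      have "(\<lambda>x. x k) \<in> borel_measurable \<nu>"
        unfolding measurable_cong_sets[OF assms(2) refl] by (rule borel_measurable_coordinate)
      from measurable_compose[OF measurable_snd this] show ?thesis .
    qed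
    have "(\<lambda>p. snd p (position (fst p) n)) \<in> borel_measurable (\<mu> \<Otimes>\<^sub>M \<nu>)"
      by (rule measurable_compose_countable[OF scen pos])
    then show ?thesis
      by (simp add: record_map_def shift_by_def case_prod_beta)
  qed
  then show ?thesis
    by (rule measurable_coordinatewise_then_product)
qed

end

theory Submission
  imports Defs
begin

text \<open>
  A record of length \<open>m + 1\<close> is the scenery read along a walk of \<open>m\<close> steps, so its probability is
  the sum, over the step words \<open>u\<close> of length \<open>m\<close>, of \<open>\<mu>[u]\<close> times the probability that the scenery
  shows the record \<open>w\<close> along \<open>u\<close> (lemma \<open>word_prob_record_measure\<close>). Since \<open>\<mu>\<close> gives the same
  weight to \<open>u\<close> and to its mirror image, the scenery measure enters only through the probability of
  reading \<open>w\<close> along \<open>u\<close> plus that of reading it along the reflected path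
  (lemma \<open>word_prob_record_measure_symmetric\<close>). Such a sum is a function of the numbers
  \<open>\<nu>[v] + \<nu>[v reversed]\<close>, where \<open>v\<close> has the length of any window that contains the path
  (lemma \<open>reading_prob_reflection_sum\<close>).

  This makes a triangular system of linear equations. Among the paths of \<open>m\<close> steps only
  the two straight ones visit \<open>m + 1\<close> sites, and these contribute a multiple of
  \<open>\<nu>[w] + \<nu>[w reversed]\<close>; every other path fits into a window of \<open>m\<close> sites
  (lemma \<open>not_straight_walk_in_short_window\<close>) and contributes a term known from shorter words.
  The diagonal coefficient is at least \<open>\<mu>[R\<^sup>m]\<close>, which is positive because the walk is
  straightforward, so the equations can be solved by induction on the length of \<open>w\<close>.
\<close>

section \<open>Reading a scenery along a path\<close>

definition reading_prob :: "(int \<Rightarrow> 'a) measure \<Rightarrow> (nat \<Rightarrow> int) \<Rightarrow> 'a list \<Rightarrow> real" where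
  "reading_prob \<nu> f w = measure \<nu> {x. \<forall>i<length w. x (f i) = w ! i}"

text \<open>
  The scenery words on the window of \<open>k\<close> sites starting at \<open>a\<close> that make the path \<open>f\<close> read \<open>w\<close>.
  When \<open>f\<close> visits a site twice with different letters of \<open>w\<close>, there are none.
\<close>

definition window_words :: "int \<Rightarrow> nat \<Rightarrow> (nat \<Rightarrow> int) \<Rightarrow> 'a list \<Rightarrow> 'a list set" where
  "window_words a k f w = {v. length v = k \<and> (\<forall>i<length w. v ! nat (f i - a) = w ! i)}"

lemma reading_prob_eq_sum_window_words:
  fixes \<nu> :: "(int \<Rightarrow> 'a::{t1_space,finite}) measure"
  assumes \<nu>: "shift_invariant_prob \<nu>"
    and f: "\<And>i. i < length w \<Longrightarrow> a \<le> f i \<and> f i < a + int k"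
  shows "reading_prob \<nu> f w = (\<Sum>v\<in>window_words a k f w. word_prob \<nu> v)"
proof -
  interpret prob_space \<nu> using \<nu> by (simp add: shift_invariant_prob_def)
  have sets_\<nu>: "sets \<nu> = sets borel" using \<nu> by (simp add: shift_invariant_prob_def)
  define C where "C v = {x :: int \<Rightarrow> 'a. \<forall>i<length v. x (int i + a) = v ! i}" for v
  have fin: "finite (window_words a k f w)"
    by (rule finite_subset[OF _ finite_lists_length_eq[of "UNIV :: 'a set" k]])
       (auto simp: window_words_def)
  have disj: "disjoint_family_on C (window_words a k f w)"
    by (force simp: disjoint_family_on_def C_def window_words_def list_eq_iff_nth_eq)
  have "{x. \<forall>i<length w. x (f i) = w ! i} = (\<Union>v\<in>window_words a k f w. C v)"
  proof (intro set_eqI iffI)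
    fix x assume x: "x \<in> {x. \<forall>i<length w. x (f i) = w ! i}"
    define v where "v = map (\<lambda>i. x (int i + a)) [0..<k]"
    have "v \<in> window_words a k f w"
      unfolding window_words_def
    proof (intro CollectI conjI allI impI)
      fix i assume i: "i < length w"
      then have "nat (f i - a) < k" "int (nat (f i - a)) + a = f i"
        using f[OF i] by auto
      then show "v ! nat (f i - a) = w ! i"
        using x i by (simp add: v_def)
    qed (simp add: v_def)
    moreover have "x \<in> C v" by (simp add: C_def v_def)
    ultimately show "x \<in> (\<Union>v\<in>window_words a k f w. C v)" by blast
  next
    fix x assume "x \<in> (\<Union>v\<in>window_words a k f w. C v)"
    then obtain v where v: "length v = k" "\<forall>i<length w. v ! nat (f i - a) = w ! i"
        and x: "x \<in> C v"
      by (auto simp: window_words_def)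
    have "x (f i) = w ! i" if i: "i < length w" for i
    proof -
      have "nat (f i - a) < length v" and eq: "int (nat (f i - a)) + a = f i"
        using f[OF i] v(1) by auto
      then have "x (int (nat (f i - a)) + a) = v ! nat (f i - a)"
        using x unfolding C_def by blast
      then show ?thesis using v(2) i by (simp only: eq)
    qed
    then show "x \<in> {x. \<forall>i<length w. x (f i) = w ! i}" by blast
  qed
  moreover have "measure \<nu> (\<Union>v\<in>window_words a k f w. C v)
      = (\<Sum>v\<in>window_words a k f w. measure \<nu> (C v))"
    by (rule finite_measure_finite_Union[OF fin _ disj])
       (auto simp: sets_\<nu> C_def borel_measurable_word)
  ultimately show ?thesis
    by (simp add: reading_prob_def C_def shift_invariant_window[OF \<nu>])
qed

text \<open>
  Reflecting the path moves the window \<open>{a..<a + k}\<close> to the one that starts at \<open>1 - a - k\<close>, and the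
  same scenery is then met in the opposite order.
\<close>

lemma window_words_reflection:
  assumes f: "\<And>i. i < length w \<Longrightarrow> a \<le> f i \<and> f i < a + int k"
  shows "window_words (1 - a - int k) k (\<lambda>i. - f i) w = rev ` window_words a k f w"
proof -
  have idx: "nat (- f i - (1 - a - int k)) = k - Suc (nat (f i - a))" "nat (f i - a) < k"
    if "i < length w" for i
    using f[OF that] by auto
  have mem: "v \<in> window_words (1 - a - int k) k (\<lambda>i. - f i) w \<longleftrightarrow> rev v \<in> window_words a k f w"
    for v
    using idx by (auto simp: window_words_def rev_nth)
  show ?thesis
  proof (intro set_eqI)
    fix v
    have "v \<in> rev ` window_words a k f w \<longleftrightarrow> rev v \<in> window_words a k f w"
      by (metis (no_types, lifting) image_iff rev_rev_ident)
    then show "v \<in> window_words (1 - a - int k) k (\<lambda>i. - f i) w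
        \<longleftrightarrow> v \<in> rev ` window_words a k f w"
      by (simp add: mem)
  qed
qed

lemma reading_prob_reflection_sum:
  fixes \<nu> :: "(int \<Rightarrow> 'a::{t1_space,finite}) measure"
  assumes \<nu>: "shift_invariant_prob \<nu>"
    and f: "\<And>i. i < length w \<Longrightarrow> a \<le> f i \<and> f i < a + int k"
  shows "reading_prob \<nu> f w + reading_prob \<nu> (\<lambda>i. - f i) w
    = (\<Sum>v\<in>window_words a k f w. word_prob \<nu> v + word_prob \<nu> (rev v))"
proof -
  have "reading_prob \<nu> (\<lambda>i. - f i) w
      = (\<Sum>v\<in>window_words (1 - a - int k) k (\<lambda>i. - f i) w. word_prob \<nu> v)"
  proof (rule reading_prob_eq_sum_window_words[OF \<nu>])
    fix i assume "i < length w"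
    from f[OF this] show "1 - a - int k \<le> - f i \<and> - f i < 1 - a - int k + int k" by auto
  qed
  also have "\<dots> = (\<Sum>v\<in>rev ` window_words a k f w. word_prob \<nu> v)"
    by (simp only: window_words_reflection[OF f])
  also have "\<dots> = (\<Sum>v\<in>window_words a k f w. word_prob \<nu> (rev v))"
    by (simp add: sum.reindex)
  finally show ?thesis
    by (simp add: reading_prob_eq_sum_window_words[OF \<nu> f] sum.distrib)
qed


section \<open>Paths of step words\<close>

definition walk_position :: "step list \<Rightarrow> nat \<Rightarrow> int" where
  "walk_position u i = sum_list (map displacement (take i u))"

lemma position_eq_walk_position:
  assumes "\<forall>j<length u. \<omega> (int j) = u ! j" and "i \<le> length u"
  shows "position \<omega> (int i) = walk_position u i"
  using assms(2)
proof (induction i)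
  case 0
  then show ?case by (simp add: position_def walk_position_def)
next
  case (Suc i)
  have "{0..<int (Suc i)} = insert (int i) {0..<int i}" by auto
  then show ?case
    using Suc assms(1) by (simp add: position_def walk_position_def take_Suc_conv_app_nth)
qed

lemma walk_position_mirror: "walk_position (map mirror u) i = - walk_position u i"
proof -
  have "displacement (mirror s) = - displacement s" for s
    by (cases s) auto
  then show ?thesis
    by (simp add: walk_position_def take_map uminus_sum_list_map o_def)
qed

lemma walk_position_snoc:
  "walk_position (u @ [s]) i
    = (if i \<le> length u then walk_position u i else walk_position u (length u) + displacement s)"
  by (simp add: walk_position_def)

lemma walk_position_replicate:
  "walk_position (replicate m s) i = int (min i m) * displacement s"
  by (simp add: walk_position_def sum_list_replicate min.commute)

text \<open>
  The last step of a path enlarges its range by at most one site, so a path that has once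
  failed to reach a new site stays at least one site short of the maximum.
\<close>

lemma not_straight_walk_in_short_window:
  assumes "u \<noteq> replicate (length u) Right" and "u \<noteq> replicate (length u) Left"
  shows "\<exists>a. \<forall>i\<le>length u. a \<le> walk_position u i \<and> walk_position u i < a + int (length u)"
  using assms
proof (induction u rule: rev_induct)
  case Nil
  then show ?case by simp
next
  case (snoc s u)
  have snoc_replicate: "replicate n c @ [c] = replicate (Suc n) c" for n and c :: step
    by (simp add: replicate_append_same)
  consider (right) "u = replicate (length u) Right"
    | (left) "u = replicate (length u) Left" "u \<noteq> []"
    | (bent) "u \<noteq> replicate (length u) Right" "u \<noteq> replicate (length u) Left"
    by fastforce
  then show ?case
  proof cases
    case right
    define m where "m = length u"
    have u: "u = replicate m Right" using right by (simp add: m_def)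
    have "s \<noteq> Right" using snoc.prems(1) by (auto simp: u snoc_replicate)
    moreover have "s \<noteq> Left \<or> m > 0" using snoc.prems(2) by (cases "m = 0") (auto simp: u)
    ultimately have "displacement s = 0 \<or> displacement s = - 1 \<and> m > 0" by (cases s) auto
    then show ?thesis
      by (intro exI[of _ 0]) (auto simp: u walk_position_snoc walk_position_replicate)
  next
    case left
    define m where "m = length u"
    have u: "u = replicate m Left" using left by (simp add: m_def)
    have "m > 0" using left by (simp add: m_def)
    moreover have "s \<noteq> Left" using snoc.prems(2) by (auto simp: u snoc_replicate)
    ultimately have "displacement s = 0 \<or> displacement s = 1" "m > 0" by (cases s; auto)+
    then show ?thesis
      by (intro exI[of _ "- int m"]) (auto simp: u walk_position_snoc walk_position_replicate)
  next
    case bent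
    from snoc.IH[OF this] obtain a where
      a: "a \<le> walk_position u i \<and> walk_position u i < a + int (length u)" if "i \<le> length u" for i
      by blast
    show ?thesis
    proof (intro exI[of _ "a + min 0 (displacement s)"] allI impI)
      fix i
      show "a + min 0 (displacement s) \<le> walk_position (u @ [s]) i \<and>
          walk_position (u @ [s]) i < a + min 0 (displacement s) + int (length (u @ [s]))"
        using a[of i] a[of "length u"] by (cases s) (auto simp: walk_position_snoc)
    qed
  qed
qed


section \<open>Records as mixtures over paths\<close>

lemma finite_step_words: "finite {u :: step list. length u = m}"
  using finite_lists_length_eq[of "UNIV :: step set" m] by simp

lemma word_prob_record_measure:
  assumes \<mu>: "shift_invariant_prob \<mu>" and \<nu>: "shift_invariant_prob \<nu>"
    and w: "length w = Suc m"
  shows "word_prob (record_measure \<mu> \<nu>) w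
    = (\<Sum>u | length u = m. word_prob \<mu> u * reading_prob \<nu> (walk_position u) w)"
proof -
  have sets_\<mu>: "sets \<mu> = sets borel" and sets_\<nu>: "sets \<nu> = sets borel"
    using \<mu> \<nu> by (auto simp: shift_invariant_prob_def)
  have space: "space (\<mu> \<Otimes>\<^sub>M \<nu>) = UNIV"
    using sets_eq_imp_space_eq[OF sets_\<mu>] sets_eq_imp_space_eq[OF sets_\<nu>]
    by (simp add: space_pair_measure)
  interpret \<mu>: prob_space \<mu> using \<mu> by (simp add: shift_invariant_prob_def)
  interpret \<nu>: prob_space \<nu> using \<nu> by (simp add: shift_invariant_prob_def)
  interpret pair_prob_space \<mu> \<nu> ..
  define C where "C u = {\<omega> :: int \<Rightarrow> step. \<forall>i<length u. \<omega> (int i) = u ! i}" for u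
  define D where "D u = {x :: int \<Rightarrow> bool. \<forall>i<length w. x (walk_position u i) = w ! i}" for u
  have sets_C: "C u \<in> sets \<mu>" for u
    unfolding C_def sets_\<mu> by (rule borel_measurable_word)
  have sets_D: "D u \<in> sets \<nu>" for u
    unfolding D_def sets_\<nu> by (rule borel_measurable_word)
  have pre: "record_map -` {x. \<forall>i<length w. x (int i) = w ! i}
      = (\<Union>u\<in>{u. length u = m}. C u \<times> D u)" (is "?E = ?U")
  proof (intro set_eqI iffI)
    fix p assume p: "p \<in> ?E"
    obtain \<omega> x where [simp]: "p = (\<omega>, x)" by (cases p)
    define u where "u = map (\<lambda>i. \<omega> (int i)) [0..<m]"
    have u: "length u = m" "\<forall>j<length u. \<omega> (int j) = u ! j"
      by (simp_all add: u_def)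
    then have "\<omega> \<in> C u" by (simp add: C_def)
    moreover have "x \<in> D u"
      using p position_eq_walk_position[OF u(2)] w u(1)
      by (auto simp: D_def record_map_def shift_by_def)
    ultimately show "p \<in> ?U" using u(1) by auto
  next
    fix p assume "p \<in> ?U"
    then obtain \<omega> x u where [simp]: "p = (\<omega>, x)" and u: "length u = m" "\<omega> \<in> C u" "x \<in> D u"
      by auto
    have "position \<omega> (int i) = walk_position u i" if "i < length w" for i
      by (rule position_eq_walk_position) (use u w that in \<open>auto simp: C_def\<close>)
    then show "p \<in> ?E"
      using u(3) by (auto simp: D_def record_map_def shift_by_def)
  qed
  have "word_prob (record_measure \<mu> \<nu>) w = measure (\<mu> \<Otimes>\<^sub>M \<nu>) (?E \<inter> space (\<mu> \<Otimes>\<^sub>M \<nu>))"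
    unfolding word_prob_def record_measure_def
    by (rule measure_distr[OF measurable_record_map[OF sets_\<mu> sets_\<nu>] borel_measurable_word])
  also have "\<dots> = measure (\<mu> \<Otimes>\<^sub>M \<nu>) ?U"
    by (simp only: pre space Int_UNIV_right)
  also have "\<dots> = (\<Sum>u | length u = m. measure (\<mu> \<Otimes>\<^sub>M \<nu>) (C u \<times> D u))"
  proof (rule finite_measure_finite_Union[OF finite_step_words])
    show "disjoint_family_on (\<lambda>u. C u \<times> D u) {u. length u = m}"
      by (force simp: disjoint_family_on_def C_def list_eq_iff_nth_eq)
  qed (auto intro: sets_C sets_D)
  also have "\<dots> = (\<Sum>u | length u = m. measure \<mu> (C u) * measure \<nu> (D u))"
    by (simp add: measure_def \<nu>.emeasure_pair_measure_Times[OF sets_C sets_D] enn2real_mult)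
  finally show ?thesis
    by (simp add: word_prob_def reading_prob_def C_def D_def)
qed

lemma word_prob_record_measure_symmetric:
  assumes \<mu>: "shift_invariant_prob \<mu>" "symmetric_walk \<mu>" and \<nu>: "shift_invariant_prob \<nu>"
    and w: "length w = Suc m"
  shows "2 * word_prob (record_measure \<mu> \<nu>) w
    = (\<Sum>u | length u = m. word_prob \<mu> u *
        (reading_prob \<nu> (walk_position u) w + reading_prob \<nu> (\<lambda>i. - walk_position u i) w))"
proof -
  have mm: "mirror (mirror s) = s" for s by (cases s) auto
  have "bij_betw (map mirror) {u. length u = m} {u. length u = m}"
    by (rule bij_betwI[where g = "map mirror"]) (auto simp: o_def mm)
  from sum.reindex_bij_betw[OF this,
      of "\<lambda>u. word_prob \<mu> u * reading_prob \<nu> (walk_position u) w", symmetric]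
  have "word_prob (record_measure \<mu> \<nu>) w
      = (\<Sum>u | length u = m. word_prob \<mu> u * reading_prob \<nu> (\<lambda>i. - walk_position u i) w)"
    using \<mu>(2)
    by (simp add: word_prob_record_measure[OF \<mu>(1) \<nu> w] walk_position_mirror[abs_def]
        symmetric_walk_def)
  with word_prob_record_measure[OF \<mu>(1) \<nu> w] show ?thesis
    by (simp add: sum.distrib distrib_left)
qed


section \<open>Solving for the symmetrized word probabilities\<close>

lemma reading_prob_straight_walk:
  fixes \<nu> :: "(int \<Rightarrow> 'a::{t1_space,finite}) measure"
  assumes \<nu>: "shift_invariant_prob \<nu>" and w: "length w = Suc m"
    and u: "u = replicate m Right \<or> u = replicate m Left"
  shows "reading_prob \<nu> (walk_position u) w + reading_prob \<nu> (\<lambda>i. - walk_position u i) w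
    = word_prob \<nu> w + word_prob \<nu> (rev w)"
proof -
  have words: "window_words 0 (length w) int w = {w}"
    by (auto simp: window_words_def list_eq_iff_nth_eq)
  have int: "reading_prob \<nu> int w + reading_prob \<nu> (\<lambda>i. - int i) w
      = word_prob \<nu> w + word_prob \<nu> (rev w)"
    using reading_prob_reflection_sum[OF \<nu>, of w 0 int "length w"] by (simp add: words)
  have cong: "reading_prob \<nu> f w = reading_prob \<nu> g w" if "\<And>i. i \<le> m \<Longrightarrow> f i = g i" for f g
    using that by (simp add: reading_prob_def w less_Suc_eq_le)
  from u show ?thesis
  proof
    assume u: "u = replicate m Right"
    have "reading_prob \<nu> (walk_position u) w = reading_prob \<nu> int w"
      "reading_prob \<nu> (\<lambda>i. - walk_position u i) w = reading_prob \<nu> (\<lambda>i. - int i) w"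
      by (rule cong; simp add: u walk_position_replicate)+
    with int show ?thesis by simp
  next
    assume u: "u = replicate m Left"
    have "reading_prob \<nu> (walk_position u) w = reading_prob \<nu> (\<lambda>i. - int i) w"
      "reading_prob \<nu> (\<lambda>i. - walk_position u i) w = reading_prob \<nu> int w"
      by (rule cong; simp add: u walk_position_replicate)+
    with int show ?thesis by simp
  qed
qed

lemma symmetrized_word_prob_determined:
  assumes \<mu>: "shift_invariant_prob \<mu>" "symmetric_walk \<mu>" "straightforward_walk \<mu>"
    and \<nu>: "shift_invariant_prob \<nu>" and \<nu>': "shift_invariant_prob \<nu>'"
    and eq: "record_measure \<mu> \<nu> = record_measure \<mu> \<nu>'"
  shows "word_prob \<nu> w + word_prob \<nu> (rev w) = word_prob \<nu>' w + word_prob \<nu>' (rev w)"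
proof (induction "length w" arbitrary: w)
  case 0
  have "word_prob \<nu> [] = 1" "word_prob \<nu>' [] = 1"
    using \<nu> \<nu>' prob_space.prob_space sets_eq_imp_space_eq[of \<nu> borel]
      sets_eq_imp_space_eq[of \<nu>' borel]
    by (force simp: word_prob_def shift_invariant_prob_def)+
  with 0 show ?case by simp
next
  case (Suc m)
  then have w: "length w = Suc m" by simp
  define S where "S \<kappa> u = reading_prob \<kappa> (walk_position u) w
      + reading_prob \<kappa> (\<lambda>i. - walk_position u i) w" for \<kappa> u
  \<comment> \<open>A set, because the two straight words coincide when \<open>m = 0\<close>.\<close>
  define A where "A = {replicate m Right, replicate m Left}"
  define c where "c = sum (word_prob \<mu>) A"
  have A: "A \<subseteq> {u. length u = m}" "finite A" by (auto simp: A_def)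
  have bent: "S \<nu> u = S \<nu>' u" if u: "u \<in> {u. length u = m} - A" for u
  proof -
    have "length u = m" using u by simp
    moreover have "\<exists>a. \<forall>i\<le>length u. a \<le> walk_position u i \<and> walk_position u i < a + int (length u)"
      by (rule not_straight_walk_in_short_window) (use u in \<open>auto simp: A_def\<close>)
    ultimately obtain a where
      a: "a \<le> walk_position u i \<and> walk_position u i < a + int m" if "i < length w" for i
      by (auto simp: w less_Suc_eq_le)
    have window: "S \<kappa> u = (\<Sum>v\<in>window_words a m (walk_position u) w.
        word_prob \<kappa> v + word_prob \<kappa> (rev v))" if "shift_invariant_prob \<kappa>" for \<kappa>
      unfolding S_def by (rule reading_prob_reflection_sum[OF that a])
    show ?thesis
      unfolding window[OF \<nu>] window[OF \<nu>']
      by (intro sum.cong refl Suc.hyps(1)) (simp add: window_words_def)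
  qed
  have split: "2 * word_prob (record_measure \<mu> \<kappa>) w
      = (\<Sum>u\<in>{u. length u = m} - A. word_prob \<mu> u * S \<kappa> u)
        + c * (word_prob \<kappa> w + word_prob \<kappa> (rev w))"
    if \<kappa>: "shift_invariant_prob \<kappa>" for \<kappa>
  proof -
    have "2 * word_prob (record_measure \<mu> \<kappa>) w = (\<Sum>u | length u = m. word_prob \<mu> u * S \<kappa> u)"
      unfolding S_def by (rule word_prob_record_measure_symmetric[OF \<mu>(1,2) \<kappa> w])
    also have "\<dots> = (\<Sum>u\<in>{u. length u = m} - A. word_prob \<mu> u * S \<kappa> u)
        + (\<Sum>u\<in>A. word_prob \<mu> u * S \<kappa> u)"
      by (rule sum.subset_diff[OF A(1) finite_step_words])
    also have "(\<Sum>u\<in>A. word_prob \<mu> u * S \<kappa> u)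
        = (\<Sum>u\<in>A. word_prob \<mu> u * (word_prob \<kappa> w + word_prob \<kappa> (rev w)))"
    proof (intro sum.cong refl)
      fix u assume "u \<in> A"
      then have "S \<kappa> u = word_prob \<kappa> w + word_prob \<kappa> (rev w)"
        unfolding S_def A_def by (intro reading_prob_straight_walk[OF \<kappa> w]) auto
      then show "word_prob \<mu> u * S \<kappa> u
          = word_prob \<mu> u * (word_prob \<kappa> w + word_prob \<kappa> (rev w))" by simp
    qed
    finally show ?thesis by (simp add: c_def sum_distrib_right)
  qed
  have "c * (word_prob \<nu> w + word_prob \<nu> (rev w)) = c * (word_prob \<nu>' w + word_prob \<nu>' (rev w))"
  proof -
    have "(\<Sum>u\<in>{u. length u = m} - A. word_prob \<mu> u * S \<nu> u)
        = (\<Sum>u\<in>{u. length u = m} - A. word_prob \<mu> u * S \<nu>' u)"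
      by (intro sum.cong refl) (simp only: bent)
    then show ?thesis
      using split[OF \<nu>] split[OF \<nu>'] by (simp only: eq add_left_cancel)
  qed
  moreover have "c > 0"
  proof -
    have "0 < word_prob \<mu> (replicate m Right)"
    proof (cases "m = 0")
      case True
      have "prob_space \<mu>" "space \<mu> = UNIV"
        using \<mu>(1) sets_eq_imp_space_eq[of \<mu> borel] by (auto simp: shift_invariant_prob_def)
      then show ?thesis
        using True prob_space.prob_space[of \<mu>] by (simp add: word_prob_def)
    next
      case False
      then show ?thesis using \<mu>(3) by (simp add: straightforward_walk_def)
    qed
    also have "\<dots> \<le> c"
      unfolding c_def by (rule member_le_sum) (auto simp: A_def word_prob_def)
    finally show ?thesis .
  qed
  ultimately show ?case by simp
qed

theorem theorem2:
  fixes \<mu> :: "(int \<Rightarrow> step) measure" and \<nu> \<nu>' :: "(int \<Rightarrow> bool) measure"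
  assumes "ergodic_shift_prob \<mu>"
    and "symmetric_walk \<mu>"
    and "straightforward_walk \<mu>"
    and "scenery_measure \<nu>"
    and "scenery_measure \<nu>'"
    and "record_measure \<mu> \<nu> = record_measure \<mu> \<nu>'"
  shows "reversal_symmetrized \<nu> = reversal_symmetrized \<nu>'"
proof -
  have "word_prob \<nu> w + word_prob \<nu> (rev w) = word_prob \<nu>' w + word_prob \<nu>' (rev w)" for w
    by (rule symmetrized_word_prob_determined) (use assms in \<open>auto simp: ergodic_shift_prob_def\<close>)
  then show ?thesis
    by (simp add: reversal_symmetrized_def is_reversal_symmetrized_def)
qed

end
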